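(* As $k\to\infty$ through the positive integers, $$\left|\frac{R(k)}{k}-c_k\right|\le\frac{3\sqrt{\pi}}{16}\,k^{-3/2}+O(k^{-2}),$$ that is, there is a constant $C$ such that $\left|\frac{R(k)}{k}-c_k\right|\le\frac{3\sqrt{\pi}}{16}k^{-3/2}+Ck^{-2}$ for all sufficiently large positive integers $k$.
   Context: Let $\zeta$ denote the Riemann zeta function. For real $x$ define the Riesz function $$R(x) = x\sum_{k=0}^{\infty}\frac{(-1)^k x^k}{k!\,\zeta(2k+2)},$$ and for integers $k\ge 0$ define the Báez-Duarte sequence $$c_k=\sum_{j=0}^{k}(-1)^j\binom{k}{j}\frac{1}{\zeta(2j+2)}.$$ *)

theory Defs
  imports "HOL-Analysis.Analysis"
begin

text \<open>
  The libraries contain no Riemann zeta function. Only the values at the even integers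
  \<open>2, 4, 6, \<dots>\<close> occur below, so the function is given by its Dirichlet series. This is
  meaningful for \<open>s > 1\<close> only: for \<open>s \<le> 1\<close> the series diverges and the value of the
  constant is not that of the analytic continuation.
\<close>

definition riemann_zeta :: "real \<Rightarrow> real" where
  "riemann_zeta s = (\<Sum>n. 1 / real (Suc n) powr s)"

definition riesz :: "real \<Rightarrow> real" where
  "riesz x = x * (\<Sum>k. (-1) ^ k * x ^ k / (fact k * riemann_zeta (2 * real k + 2)))"

definition baez_duarte :: "nat \<Rightarrow> real" where
  "baez_duarte k =
     (\<Sum>j=0..k. (-1) ^ j * real (k choose j) * (1 / riemann_zeta (2 * real j + 2)))"

end

theory Submission
  imports Defs "HOL-Probability.Distributions"
    "HOL-Computational_Algebra.Squarefree" "HOL-Real_Asymp.Real_Asymp"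
begin

text \<open>
  Since \<open>1 / \<zeta>(2j + 2) = \<Sum>n. \<mu>(n) / n ^ (2j + 2)\<close>, both quantities are averages of the same
  weights \<open>\<mu>(n) / n\<^sup>2\<close> over \<open>n \<ge> 1\<close>: exchanging the order of summation gives
  \<open>R(k) / k = \<Sum>n. \<mu>(n) / n\<^sup>2 * exp (-k / n\<^sup>2)\<close>, and the binomial theorem gives
  \<open>c\<^sub>k = \<Sum>n. \<mu>(n) / n\<^sup>2 * (1 - 1 / n\<^sup>2) ^ k\<close>. These steps rest on
  \<open>moebius_mu_dirichlet_series\<close> and \<open>exponential_generating_function_of_moments\<close>.

  For \<open>0 \<le> t \<le> 1\<close> the power \<open>(1 - t) ^ k\<close> differs from \<open>exp (-k t)\<close> by at most
  \<open>k t\<^sup>2 / 2 * exp (-(k - 1) t)\<close> (\<open>exp_minus_power_bounds\<close>). With \<open>t = 1 / n\<^sup>2\<close> and the trivial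
  estimate \<open>\<bar>\<mu>(n)\<bar> \<le> 1\<close>, the difference is at most
  \<open>k / 2 * (\<Sum>n. n ^ (-6) * exp (-m / n\<^sup>2))\<close> where \<open>m = k - 1\<close>.

  The function \<open>f(x) = x ^ (-6) * exp (-m / x\<^sup>2)\<close> first increases and then decreases, so the sum of
  its values at the integers exceeds its integral by at most its maximum, which has order
  \<open>m ^ (-3)\<close> and therefore contributes only to the \<open>O(k ^ (-2))\<close> term
  (\<open>sum_le_integral_plus_max_unimodal\<close>). The substitution \<open>t = sqrt m / x\<close> turns the integral
  into a multiple of a Gaussian moment,
  \<open>m ^ (-5/2) * \<integral> t ^ 4 * exp (-t\<^sup>2) = 3 * sqrt pi / 8 * m ^ (-5/2)\<close>, the integral being over
  \<open>t \<ge> 0\<close>. Multiplication by \<open>k / 2\<close> gives the constant \<open>3 * sqrt pi / 16\<close>.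
\<close>

section \<open>The Dirichlet series of the Moebius function\<close>

definition moebius_mu :: "nat \<Rightarrow> real" where
  "moebius_mu n = (if squarefree n then (-1) ^ card (prime_factors n) else 0)"

lemma abs_moebius_mu_le_1: "\<bar>moebius_mu n\<bar> \<le> 1"
  by (simp add: moebius_mu_def)

lemma moebius_mu_prime_mult:
  assumes "prime p" "\<not> p dvd d"
  shows "moebius_mu (p * d) = - moebius_mu d"
proof -
  have d: "d \<noteq> 0" using assms(2) by (metis dvd_0_right)
  have p: "p \<noteq> 0" using assms(1) by auto
  have cop: "coprime p d" using assms by (simp add: prime_imp_coprime)
  have "squarefree (p * d) \<longleftrightarrow> squarefree d"
    using cop squarefree_mult_coprime squarefree_prime[OF assms(1)] squarefree_multD(2) by blast
  moreover have "prime_factors (p * d) = insert p (prime_factors d)"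
    using assms(1) d p by (simp add: prime_factors_product prime_prime_factors)
  moreover have "p \<notin> prime_factors d" using assms(2) by (auto simp: in_prime_factors_iff)
  ultimately show ?thesis by (simp add: moebius_mu_def)
qed

text \<open>
  Fix a prime \<open>p\<close> dividing \<open>n > 1\<close>. The squarefree divisors of \<open>n\<close> come in pairs \<open>d\<close>, \<open>p d\<close> with
  \<open>p\<close> not dividing \<open>d\<close>, and the two contributions of a pair cancel.
\<close>

lemma sum_moebius_mu_divisors:
  assumes "n > 0"
  shows "(\<Sum>d | d dvd n. moebius_mu d) = (if n = 1 then 1 else 0)"
proof (cases "n = 1")
  case True
  then show ?thesis by (simp add: moebius_mu_def)
next
  case False
  then obtain p where p: "prime p" "p dvd n" using prime_factor_nat by blast
  define A where "A = {d. d dvd n \<and> \<not> p dvd d}"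
  have fin: "finite {d. d dvd n}" using assms by simp
  have finA: "finite A" unfolding A_def by (rule finite_subset[OF _ fin]) auto
  have inj: "inj_on ((*) p) A" using p(1) by (auto simp: inj_on_def)
  have disj: "A \<inter> (*) p ` A = {}" by (auto simp: A_def)
  \<comment> \<open>A divisor outside both sets is divisible by \<open>p\<^sup>2\<close>, so it contributes nothing.\<close>
  have "(\<Sum>d | d dvd n. moebius_mu d) = (\<Sum>d \<in> A \<union> (*) p ` A. moebius_mu d)"
  proof (rule sum.mono_neutral_right[OF fin])
    show "A \<union> (*) p ` A \<subseteq> {d. d dvd n}"
      using p by (auto simp: A_def intro!: divides_mult prime_imp_coprime)
    show "\<forall>d\<in>{d. d dvd n} - (A \<union> (*) p ` A). moebius_mu d = 0"
    proof
      fix d assume d: "d \<in> {d. d dvd n} - (A \<union> (*) p ` A)"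
      then obtain e where e: "d = p * e" by (auto simp: A_def)
      have "e dvd n" using d e by (auto dest: dvd_mult_right)
      with d e have "p dvd e" by (auto simp: A_def)
      then have "p\<^sup>2 dvd d" using e by (simp add: power2_eq_square)
      then have "\<not> squarefree d" using p(1) by (intro not_squarefreeI) auto
      then show "moebius_mu d = 0" by (simp add: moebius_mu_def)
    qed
  qed
  also have "\<dots> = (\<Sum>d\<in>A. moebius_mu d) + (\<Sum>d\<in>A. moebius_mu (p * d))"
    using finA disj inj by (simp add: sum.union_disjoint sum.reindex)
  also have "(\<Sum>d\<in>A. moebius_mu (p * d)) = - (\<Sum>d\<in>A. moebius_mu d)"
    using p(1) by (simp add: A_def moebius_mu_prime_mult sum_negf)
  finally show ?thesis using False by simp
qed

lemma summable_on_Times_dominated: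
  fixes f :: "nat \<times> nat \<Rightarrow> real"
  assumes "a summable_on A" "b summable_on B"
    and bound: "\<And>i j. i \<in> A \<Longrightarrow> j \<in> B \<Longrightarrow> \<bar>f (i, j)\<bar> \<le> a i * b j"
    and nonneg: "\<And>i. i \<in> A \<Longrightarrow> 0 \<le> a i" "\<And>j. j \<in> B \<Longrightarrow> 0 \<le> b j"
  shows "f summable_on A \<times> B"
proof -
  have "(\<lambda>(i, j). a i * b j) summable_on A \<times> B"
  proof (rule summable_on_SigmaI)
    show "((\<lambda>j. case (i, j) of (i, j) \<Rightarrow> a i * b j) has_sum a i * infsum b B) B" for i
      using assms(2) by (auto intro: has_sum_cmult_right)
    show "(\<lambda>i. a i * infsum b B) summable_on A"
      using assms(1) by (rule summable_on_cmult_left)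
  qed (use nonneg in auto)
  then have "(\<lambda>x. norm (f x)) summable_on A \<times> B"
    by (rule summable_on_comparison_test) (use bound in auto)
  then show ?thesis by (rule abs_summable_summable)
qed

lemma has_sum_positive_nat_iff:
  "(f has_sum S) {0<..} \<longleftrightarrow> ((\<lambda>n. f (Suc n)) has_sum S) UNIV"
proof -
  have "{0<..} = range Suc" by (auto simp: image_iff gr0_conv_Suc)
  then show ?thesis using has_sum_reindex[of Suc UNIV f S] by (simp add: o_def)
qed

text \<open>
  The product of the two absolutely convergent series \<open>\<Sum>d. \<mu>(d) / d ^ s\<close> and \<open>\<Sum>m. 1 / m ^ s\<close> is a sum
  over all pairs \<open>(d, m)\<close>. Collecting the pairs with the same product \<open>n = d m\<close> leaves
  \<open>(\<Sum>d dvd n. \<mu>(d)) / n ^ s\<close>, which vanishes except for \<open>n = 1\<close>.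
\<close>

lemma moebius_mu_dirichlet_series:
  assumes "s \<ge> 2"
  shows "(\<lambda>n. moebius_mu (Suc n) / real (Suc n) ^ s) sums (1 / riemann_zeta (real s))"
proof -
  define P where "P = {0::nat<..}"
  have sm: "summable (\<lambda>n. 1 / real (Suc n) ^ s)"
    using inverse_power_summable[of s, where 'a = real] assms
    by (subst summable_Suc_iff[where f = "\<lambda>n. 1 / real n ^ s"]) (simp add: inverse_eq_divide)
  have z: "riemann_zeta (real s) = (\<Sum>n. 1 / real (Suc n) ^ s)"
    unfolding riemann_zeta_def by (simp add: powr_realpow)
  have zeta: "((\<lambda>n. 1 / real n ^ s) has_sum riemann_zeta (real s)) P"
    unfolding P_def has_sum_positive_nat_iff z
    by (rule norm_summable_imp_has_sum) (use sm summable_sums in auto)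
  have smu: "summable (\<lambda>n. norm (moebius_mu (Suc n) / real (Suc n) ^ s))"
    by (rule summable_comparison_test'[OF sm])
       (simp add: abs_moebius_mu_le_1 divide_right_mono)
  define M where "M = (\<Sum>n. moebius_mu (Suc n) / real (Suc n) ^ s)"
  have sumsM: "(\<lambda>n. moebius_mu (Suc n) / real (Suc n) ^ s) sums M"
    unfolding M_def by (rule summable_sums[OF summable_norm_cancel[OF smu]])
  have mu: "((\<lambda>n. moebius_mu n / real n ^ s) has_sum M) P"
    unfolding P_def has_sum_positive_nat_iff by (rule norm_summable_imp_has_sum[OF smu sumsM])
  define f where "f = (\<lambda>(d, m). moebius_mu d / real d ^ s * (1 / real m ^ s))"
  have "f summable_on P \<times> P"
  proof (rule summable_on_Times_dominated)
    show "(\<lambda>n. 1 / real n ^ s) summable_on P" "(\<lambda>n. 1 / real n ^ s) summable_on P"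
      using zeta by (auto simp: summable_on_def)
    show "\<bar>f (d, m)\<bar> \<le> 1 / real d ^ s * (1 / real m ^ s)" for d m
      by (simp add: f_def abs_mult abs_moebius_mu_le_1 divide_right_mono)
  qed auto
  have "(f has_sum M * riemann_zeta (real s)) (P \<times> P)"
  proof (rule has_sum_SigmaI)
    show "((\<lambda>m. f (d, m)) has_sum moebius_mu d / real d ^ s * riemann_zeta (real s)) P" for d
      unfolding f_def prod.case by (rule has_sum_cmult_right[OF zeta])
    show "((\<lambda>d. moebius_mu d / real d ^ s * riemann_zeta (real s)) has_sum M * riemann_zeta (real s)) P"
      by (rule has_sum_cmult_left[OF mu])
  qed fact
  also have "(f has_sum M * riemann_zeta (real s)) (P \<times> P) \<longleftrightarrow>
      ((\<lambda>(n, d). moebius_mu d / real n ^ s) has_sum M * riemann_zeta (real s))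
        (Sigma P (\<lambda>n. {d. d dvd n}))"
    by (rule has_sum_reindex_bij_witness
          [where i = "\<lambda>(n, d). (d, n div d)" and j = "\<lambda>(d, m). (d * m, d)"])
       (auto simp: P_def f_def power_mult_distrib dvd_div_eq_0_iff intro!: Nat.gr0I)
  finally have 1: "((\<lambda>n. if n = 1 then 1 else 0) has_sum M * riemann_zeta (real s)) P"
  proof (rule has_sum_SigmaD)
    fix n assume n: "n \<in> P"
    have "((\<lambda>d. moebius_mu d / real n ^ s) has_sum (\<Sum>d | d dvd n. moebius_mu d / real n ^ s)) {d. d dvd n}"
      using n by (intro has_sum_finite) (auto simp: P_def)
    also have "(\<Sum>d | d dvd n. moebius_mu d / real n ^ s) = (if n = 1 then 1 else 0)"
      using n sum_moebius_mu_divisors[of n] by (simp add: P_def flip: sum_divide_distrib)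
    finally show "((\<lambda>d. case (n, d) of (n, d) \<Rightarrow> moebius_mu d / real n ^ s)
        has_sum (if n = 1 then 1 else 0)) {d. d dvd n}" by simp
  qed
  have 2: "((\<lambda>n. if n = 1 then 1 else 0 :: real) has_sum 1) P"
    by (rule has_sum_finite_neutralI[where B = "{1}"]) (auto simp: P_def)
  have "M * riemann_zeta (real s) = 1" by (rule has_sum_unique[OF 1 2])
  then have "M = 1 / riemann_zeta (real s)" by (metis mult_zero_right nonzero_eq_divide_eq zero_neq_one)
  with sumsM show ?thesis by simp
qed

section \<open>Exponential series of a moment sequence\<close>

text \<open>
  If \<open>b k\<close> is the \<open>k\<close>-th moment of a summable system of signed weights \<open>w n\<close> placed at the points
  \<open>t n\<close> of the unit interval, then the series \<open>\<Sum>k. x ^ k / k! * b k\<close> is the integral of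
  \<open>exp (x t)\<close> against these weights. The Riesz function at \<open>k\<close>, divided by \<open>k\<close>, is the case
  \<open>x = -k\<close>, \<open>t n = 1 / n\<^sup>2\<close>, \<open>w n = \<mu>(n) / n\<^sup>2\<close>. The order of summation may be exchanged because the
  double series is dominated by \<open>\<bar>w n\<bar> * \<bar>x\<bar> ^ k / k!\<close>.
\<close>

lemma exponential_generating_function_of_moments:
  fixes w t :: "nat \<Rightarrow> real"
  assumes w: "summable (\<lambda>n. \<bar>w n\<bar>)" and t: "\<And>n. 0 \<le> t n" "\<And>n. t n \<le> 1"
    and b: "\<And>k. (\<lambda>n. w n * t n ^ k) sums b k"
  shows "(\<lambda>n. w n * exp (x * t n)) sums (\<Sum>k. x ^ k / fact k * b k)"
proof -
  define f where "f = (\<lambda>(n, k). w n * t n ^ k * (x ^ k / fact k))"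
  have e: "summable (\<lambda>k. \<bar>x\<bar> ^ k / fact k)"
    using summable_exp[of "\<bar>x\<bar>"] by (simp add: divide_inverse mult.commute)
  have exp': "(\<lambda>k. y ^ k / fact k) sums exp y" for y :: real
    using exp_converges[of y] by (simp add: divide_inverse mult.commute)
  have wt: "\<bar>w n * t n ^ k\<bar> \<le> \<bar>w n\<bar>" for n k
    using t[of n] by (simp add: abs_mult mult_left_le power_le_one)
  have sf: "f summable_on UNIV \<times> UNIV"
  proof (rule summable_on_Times_dominated)
    show "(\<lambda>n. \<bar>w n\<bar>) summable_on UNIV" using w by (intro norm_summable_imp_summable_on) simp
    show "(\<lambda>k. \<bar>x\<bar> ^ k / fact k) summable_on UNIV" using e by (intro norm_summable_imp_summable_on) simp
    show "\<bar>f (n, k)\<bar> \<le> \<bar>w n\<bar> * (\<bar>x\<bar> ^ k / fact k)" for n k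
    proof -
      have "\<bar>f (n, k)\<bar> = \<bar>w n * t n ^ k\<bar> * (\<bar>x\<bar> ^ k / fact k)" by (simp add: f_def abs_mult power_abs)
      also have "\<dots> \<le> \<bar>w n\<bar> * (\<bar>x\<bar> ^ k / fact k)" by (rule mult_right_mono[OF wt]) simp
      finally show ?thesis .
    qed
  qed auto
  define S where "S = infsum f (UNIV \<times> UNIV)"
  have S: "(f has_sum S) (UNIV \<times> UNIV)" unfolding S_def using sf by (rule has_sum_infsum)
  have row: "((\<lambda>k. f (n, k)) has_sum w n * exp (x * t n)) UNIV" for n
  proof -
    have "((\<lambda>k. (x * t n) ^ k / fact k) has_sum exp (x * t n)) UNIV"
    proof (rule norm_summable_imp_has_sum[OF _ exp'])
      show "summable (\<lambda>k. norm ((x * t n) ^ k / fact k))"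
        using summable_exp[of "\<bar>x * t n\<bar>"]
        by (simp add: divide_inverse mult.commute[of "inverse _"] abs_mult[of "_ ^ _"] power_abs)
    qed
    from has_sum_cmult_right[OF this, of "w n"] show ?thesis
      by (simp add: f_def power_mult_distrib mult_ac)
  qed
  have rows: "((\<lambda>n. w n * exp (x * t n)) has_sum S) UNIV"
    by (rule has_sum_SigmaD[OF S row])
  have col: "((\<lambda>n. f (n, k)) has_sum x ^ k / fact k * b k) UNIV" for k
  proof -
    have "((\<lambda>n. w n * t n ^ k) has_sum b k) UNIV"
      by (rule norm_summable_imp_has_sum[OF _ b], rule summable_comparison_test'[OF w]) (use wt in simp)
    from has_sum_cmult_left[OF this, of "x ^ k / fact k"] show ?thesis
      by (simp add: f_def mult_ac)
  qed
  have "((\<lambda>k. x ^ k / fact k * b k) has_sum S) UNIV"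
  proof (rule has_sum_SigmaD)
    show "((\<lambda>(k, n). f (n, k)) has_sum S) (UNIV \<times> UNIV)"
      using S by (subst (asm) has_sum_swap) auto
  qed (use col in simp)
  then have "(\<Sum>k. x ^ k / fact k * b k) = S" by (intro sums_unique[symmetric] has_sum_imp_sums)
  with has_sum_imp_sums[OF rows] show ?thesis by simp
qed

section \<open>Comparing an exponential with a power\<close>

text \<open>
  Put \<open>a = exp (-t)\<close>. Then \<open>0 \<le> 1 - t \<le> a\<close> and \<open>a - (1 - t) \<le> t\<^sup>2 / 2\<close>, while \<open>a ^ k - (1 - t) ^ k\<close> is
  \<open>a - (1 - t)\<close> times a sum of \<open>k\<close> products, each at most \<open>a ^ (k - 1)\<close>. Factoring in this way
  costs only the replacement of \<open>k\<close> by \<open>k - 1\<close> in the exponent and covers \<open>t = 1\<close>, where the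
  logarithm of \<open>1 - t\<close> would not be defined.
\<close>

lemma exp_minus_power_bounds:
  fixes t :: real
  assumes "0 \<le> t" "t \<le> 1" "k \<ge> 1"
  shows "\<bar>exp (- real k * t) - (1 - t) ^ k\<bar> \<le> real k * t\<^sup>2 / 2 * exp (- (real k - 1) * t)"
proof -
  define a where "a = exp (- t)"
  have low: "1 - t \<le> a" unfolding a_def using exp_ge_add_one_self[of "-t"] by simp
  have up: "a - (1 - t) \<le> t\<^sup>2 / 2"
  proof -
    \<comment> \<open>The difference of the two sides vanishes at \<open>0\<close> and is increasing.\<close>
    have "(\<lambda>x. x\<^sup>2 / 2 - exp (- x) + (1 - x)) 0 \<le> (\<lambda>x. x\<^sup>2 / 2 - exp (- x) + (1 - x)) t"
    proof (rule DERIV_nonneg_imp_nondecreasing[OF assms(1)])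
      fix x :: real
      have "((\<lambda>x. x\<^sup>2 / 2 - exp (- x) + (1 - x)) has_real_derivative exp (- x) - (1 - x)) (at x)"
        by (auto intro!: derivative_eq_intros)
      moreover have "0 \<le> exp (- x) - (1 - x)" using exp_ge_add_one_self[of "- x"] by simp
      ultimately show "\<exists>y. ((\<lambda>x. x\<^sup>2 / 2 - exp (- x) + (1 - x)) has_real_derivative y) (at x) \<and> 0 \<le> y"
        by blast
    qed
    then show ?thesis by (simp add: a_def)
  qed
  have ek: "exp (- real k * t) = a ^ k" by (simp add: a_def flip: exp_of_nat_mult)
  have "a ^ k - (1 - t) ^ k = (a - (1 - t)) * (\<Sum>i<k. (1 - t) ^ (k - Suc i) * a ^ i)"
    using power_diff_sumr2[of a k "1 - t"] by simp
  moreover have "(\<Sum>i<k. (1 - t) ^ (k - Suc i) * a ^ i) \<le> (\<Sum>i<k. a ^ (k - 1))"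
  proof (rule sum_mono)
    fix i assume i: "i \<in> {..<k}"
    have "(1 - t) ^ (k - Suc i) * a ^ i \<le> a ^ (k - Suc i) * a ^ i"
      using low assms by (intro mult_right_mono power_mono) (auto simp: a_def)
    also have "\<dots> = a ^ (k - 1)" using i by (simp flip: power_add)
    finally show "(1 - t) ^ (k - Suc i) * a ^ i \<le> a ^ (k - 1)" .
  qed
  moreover have "0 \<le> (\<Sum>i<k. (1 - t) ^ (k - Suc i) * a ^ i)"
    using assms by (intro sum_nonneg) (auto simp: a_def)
  ultimately have "\<bar>a ^ k - (1 - t) ^ k\<bar> \<le> t\<^sup>2 / 2 * (real k * a ^ (k - 1))"
    using mult_mono[OF up, of "\<Sum>i<k. (1 - t) ^ (k - Suc i) * a ^ i" "real k * a ^ (k - 1)"] low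
    by (simp add: abs_mult)
  moreover have "a ^ (k - 1) = exp (- (real k - 1) * t)"
    using assms(3) by (simp add: a_def of_nat_diff algebra_simps flip: exp_of_nat_mult)
  ultimately show ?thesis unfolding ek by (simp add: mult_ac)
qed

section \<open>Sums of unimodal functions\<close>

text \<open>
  By the mean value theorem the integral of \<open>f\<close> over \<open>[n, n + 1]\<close> is a value \<open>f z\<close> with
  \<open>n < z < n + 1\<close>. Before the peak \<open>p\<close> it is at least \<open>f n\<close>, after the peak at least \<open>f (n + 1)\<close>.
  So the excess of the sum over the integral is at most the last summand \<open>f n\<close> while \<open>n \<le> p\<close>, and
  it does not increase once \<open>z \<ge> p\<close>. This invariant also handles the interval that contains
  the peak, according to the side on which \<open>z\<close> falls.
\<close>

lemma sum_le_integral_plus_max_unimodal: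
  fixes f F :: "real \<Rightarrow> real"
  assumes deriv: "\<And>x. x \<ge> 1 \<Longrightarrow> (F has_real_derivative f x) (at x)"
    and inc: "\<And>x y. 1 \<le> x \<Longrightarrow> x \<le> y \<Longrightarrow> y \<le> p \<Longrightarrow> f x \<le> f y"
    and dec: "\<And>x y. 1 \<le> x \<Longrightarrow> p \<le> x \<Longrightarrow> x \<le> y \<Longrightarrow> f y \<le> f x"
    and bound: "\<And>x. x \<ge> 1 \<Longrightarrow> f x \<le> B"
    and "M \<ge> 1"
  shows "(\<Sum>n=1..M. f (real n)) \<le> F (real M) - F 1 + B"
proof -
  define T where "T M = (\<Sum>n=1..M. f (real n)) - (F (real M) - F 1)" for M
  have "T M \<le> B \<and> (real M \<le> p \<longrightarrow> T M \<le> f (real M))" using \<open>M \<ge> 1\<close>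
  proof (induction M rule: dec_induct)
    case base
    show ?case using bound[of 1] by (simp add: T_def)
  next
    case (step n)
    have n: "real n \<ge> 1" using step.hyps by simp
    obtain z where z: "real n < z" "z < real (Suc n)"
        and Fz: "F (real (Suc n)) - F (real n) = f z"
      using MVT2[of "real n" "real (Suc n)" F f] deriv n by force
    have T: "T (Suc n) = T n + f (real (Suc n)) - f z" using Fz by (simp add: T_def)
    consider "z \<le> p" | "p \<le> z" by linarith
    then show ?case
    proof cases
      case 1
      then have "f (real n) \<le> f z" "T n \<le> f (real n)" using inc n z step.IH by auto
      then show ?thesis using T bound[of "real (Suc n)"] by auto
    next
      case 2
      then have "f (real (Suc n)) \<le> f z" using dec[of z "real (Suc n)"] n z by auto
      then show ?thesis using T step.IH z 2 by auto
    qed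
  qed
  then show ?thesis by (simp add: T_def)
qed

section \<open>The majorising sum and its Gaussian integral\<close>

text \<open>
  In terms of \<open>u = m / x\<^sup>2\<close> the function \<open>x ^ (-6) * exp (-m / x\<^sup>2)\<close> equals \<open>m ^ (-3)\<close> times
  \<open>u ^ 3 * exp (-u)\<close>, whose derivative \<open>u\<^sup>2 * (3 - u) * exp (-u)\<close> changes sign at \<open>u = 3\<close>.
\<close>

lemma cube_times_exp_mono:
  fixes u v :: real
  assumes "0 \<le> u" "u \<le> v" "v \<le> 3"
  shows "u ^ 3 * exp (- u) \<le> v ^ 3 * exp (- v)"
proof (rule DERIV_nonneg_imp_nondecreasing[OF assms(2)])
  fix x assume x: "u \<le> x" "x \<le> v"
  have "((\<lambda>u. u ^ 3 * exp (- u)) has_real_derivative x\<^sup>2 * (3 - x) * exp (- x)) (at x)"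
    by (auto intro!: derivative_eq_intros simp: power2_eq_square power3_eq_cube algebra_simps)
  moreover have "x\<^sup>2 * (3 - x) * exp (- x) \<ge> 0" using x assms by simp
  ultimately show "\<exists>y. ((\<lambda>u. u ^ 3 * exp (- u)) has_real_derivative y) (at x) \<and> 0 \<le> y" by blast
qed

lemma cube_times_exp_antimono:
  fixes u v :: real
  assumes "3 \<le> u" "u \<le> v"
  shows "v ^ 3 * exp (- v) \<le> u ^ 3 * exp (- u)"
proof (rule DERIV_nonpos_imp_nonincreasing[OF assms(2)])
  fix x assume x: "u \<le> x" "x \<le> v"
  have "((\<lambda>u. u ^ 3 * exp (- u)) has_real_derivative x\<^sup>2 * (3 - x) * exp (- x)) (at x)"
    by (auto intro!: derivative_eq_intros simp: power2_eq_square power3_eq_cube algebra_simps)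
  moreover have "x\<^sup>2 * (3 - x) * exp (- x) \<le> 0" using x assms by (simp add: mult_nonneg_nonpos mult_nonpos_nonneg)
  ultimately show "\<exists>y. ((\<lambda>u. u ^ 3 * exp (- u)) has_real_derivative y) (at x) \<and> y \<le> 0" by blast
qed

lemma cube_times_exp_le_27:
  fixes u :: real
  assumes "0 \<le> u"
  shows "u ^ 3 * exp (- u) \<le> 27"
proof -
  have "u ^ 3 * exp (- u) \<le> 3 ^ 3 * exp (- 3)"
    using cube_times_exp_mono[of u 3] cube_times_exp_antimono[of 3 u] assms by (cases "u \<le> 3") auto
  also have "\<dots> \<le> 27" by simp
  finally show ?thesis .
qed

text \<open>
  The substitution \<open>t = sqrt m / x\<close> expresses an antiderivative of \<open>x ^ (-6) * exp (-m / x\<^sup>2)\<close>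
  through this function. A finite sum needs only differences of the antiderivative, and these are
  controlled by the bounds \<open>0\<close> and \<open>3 * sqrt pi / 8\<close>, the latter being the full Gaussian moment.
\<close>

definition truncated_gaussian_moment4 :: "real \<Rightarrow> real" where
  "truncated_gaussian_moment4 y = integral {0..y} (\<lambda>t. exp (- t\<^sup>2) * t ^ 4)"

lemma truncated_gaussian_moment4_nonneg: "0 \<le> truncated_gaussian_moment4 y"
  unfolding truncated_gaussian_moment4_def by (rule integral_nonneg) (auto intro!: integrable_continuous_interval continuous_intros)

lemma truncated_gaussian_moment4_le: "truncated_gaussian_moment4 y \<le> 3 * sqrt pi / 8"
proof -
  have B: "has_bochner_integral lborel (\<lambda>x::real. indicator {0..} x *\<^sub>R (exp (-x\<^sup>2)*x^4)) (3 * sqrt pi / 8)"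
  proof -
    have c: "sqrt pi / 2 * (fact (2 * 2) / (2 ^ (2 * 2) * fact 2)) = 3 * sqrt pi / 8"
      by (simp add: fact_numeral)
    have e: "2 * 2 = (4 :: nat)" by simp
    show ?thesis using gaussian_moment_even_pos[of 2] unfolding c unfolding e .
  qed
  have "((\<lambda>x::real. indicator {0..} x *\<^sub>R (exp (-x\<^sup>2)*x^4)) has_integral (3 * sqrt pi / 8)) UNIV"
    using has_integral_integral_lborel[OF integrable.intros[OF B]]
    unfolding has_bochner_integral_integral_eq[OF B] .
  also have "(\<lambda>x::real. indicator {0..} x *\<^sub>R (exp (-x\<^sup>2)*x^4)) =
      (\<lambda>x. if x \<in> {0..} then exp (-x\<^sup>2)*x^4 else 0)"
    by auto
  finally have I: "((\<lambda>x. exp (-x\<^sup>2)*x^4) has_integral (3 * sqrt pi / 8)) {0..}"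
    unfolding has_integral_restrict_UNIV .
  show ?thesis unfolding truncated_gaussian_moment4_def
  proof (rule has_integral_subset_le[OF _ integrable_integral I])
    show "{0..y} \<subseteq> {0..}" by auto
  qed (auto intro!: integrable_continuous_interval continuous_intros)
qed

lemma truncated_gaussian_moment4_deriv:
  assumes "y > 0"
  shows "(truncated_gaussian_moment4 has_real_derivative exp (- y\<^sup>2) * y ^ 4) (at y)"
proof -
  have "((\<lambda>y. integral {0..y} (\<lambda>t. exp (- t\<^sup>2) * t ^ 4)) has_real_derivative exp (- y\<^sup>2) * y ^ 4)
      (at y within {0..y + 1})"
    using assms by (intro integral_has_real_derivative) (auto intro!: continuous_intros)
  moreover have "at y within {0..y + 1} = at y"
    using assms by (intro at_within_interior) auto
  ultimately show ?thesis by (simp add: truncated_gaussian_moment4_def[abs_def])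
qed

lemma sum_inverse_power6_gaussian_le:
  fixes m :: real
  assumes m: "m > 0"
  shows "(\<Sum>n=1..M. exp (- m / real n ^ 2) / real n ^ 6) \<le> 3 * sqrt pi / 8 / sqrt m ^ 5 + 27 / m ^ 3"
proof (cases "M = 0")
  case True
  then show ?thesis using m by simp
next
  case False
  define f where "f x = exp (- m / x ^ 2) / x ^ 6" for x
  \<comment> \<open>An antiderivative of \<open>f\<close>, obtained from the substitution \<open>t = sqrt m / x\<close>, which reverses orientation.\<close>
  define F where "F x = - (truncated_gaussian_moment4 (sqrt m / x) / sqrt m ^ 5)" for x
  have f: "f x = (m / x\<^sup>2) ^ 3 * exp (- (m / x\<^sup>2)) / m ^ 3" if "x \<ge> 1" for x
    using that m by (simp add: f_def power_divide flip: power_mult)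
  \<comment> \<open>As \<open>x\<close> grows, \<open>u = m / x\<^sup>2\<close> decreases; the peak \<open>u = 3\<close> is at \<open>x = sqrt (m / 3)\<close>.\<close>
  have anti: "m / y\<^sup>2 \<le> m / x\<^sup>2" if "1 \<le> x" "x \<le> y" for x y
    using that m by (intro divide_left_mono power_mono mult_pos_pos) auto
  have "(\<Sum>n=1..M. f (real n)) \<le> F (real M) - F 1 + 27 / m ^ 3"
  proof (rule sum_le_integral_plus_max_unimodal[where p = "sqrt (m / 3)"])
    fix x :: real assume x: "x \<ge> 1"
    have s: "sqrt m ^ 2 = m" "sqrt m > 0" using m by auto
    have "((\<lambda>x. sqrt m / x) has_real_derivative - sqrt m / x\<^sup>2) (at x)"
      using x by (auto intro!: derivative_eq_intros simp: power2_eq_square)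
    from DERIV_chain2[OF truncated_gaussian_moment4_deriv this]
    have "((\<lambda>x. truncated_gaussian_moment4 (sqrt m / x)) has_real_derivative
        exp (- (sqrt m / x)\<^sup>2) * (sqrt m / x) ^ 4 * (- sqrt m / x\<^sup>2)) (at x)"
      using x s by simp
    then have "(F has_real_derivative - (exp (- (sqrt m / x)\<^sup>2) * (sqrt m / x) ^ 4 * (- sqrt m / x\<^sup>2) / sqrt m ^ 5)) (at x)"
      unfolding F_def by (intro DERIV_minus DERIV_cdivide)
    also have "- (exp (- (sqrt m / x)\<^sup>2) * (sqrt m / x) ^ 4 * (- sqrt m / x\<^sup>2) / sqrt m ^ 5) = f x"
      using x s by (simp add: f_def power_divide field_simps eval_nat_numeral)
    finally show "(F has_real_derivative f x) (at x)" .
    show "f x \<le> 27 / m ^ 3"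
      using x m cube_times_exp_le_27[of "m / x\<^sup>2"] by (simp add: f divide_right_mono)
  next
    fix x y :: real assume xy: "1 \<le> x" "x \<le> y" "y \<le> sqrt (m / 3)"
    have "y\<^sup>2 \<le> m / 3" using xy m real_le_rsqrt real_sqrt_le_iff
      by (metis abs_of_nonneg order_trans real_sqrt_abs zero_le_one)
    then have "3 \<le> m / y\<^sup>2" using xy by (simp add: field_simps)
    then show "f x \<le> f y"
      using xy m anti[of x y] cube_times_exp_antimono by (simp add: f divide_right_mono)
  next
    fix x y :: real assume xy: "1 \<le> x" "sqrt (m / 3) \<le> x" "x \<le> y"
    have "m / 3 \<le> x\<^sup>2" using xy by (meson order_trans sqrt_le_D)
    then have "m / x\<^sup>2 \<le> 3" using xy by (simp add: field_simps)
    then show "f y \<le> f x"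
      using xy m anti[of x y] cube_times_exp_mono[of "m / y\<^sup>2" "m / x\<^sup>2"] by (simp add: f divide_right_mono)
  qed (use False in simp)
  also have "F (real M) - F 1 \<le> 3 * sqrt pi / 8 / sqrt m ^ 5"
  proof -
    have "0 \<le> truncated_gaussian_moment4 (sqrt m / real M) / sqrt m ^ 5" using m truncated_gaussian_moment4_nonneg by simp
    moreover have "truncated_gaussian_moment4 (sqrt m) / sqrt m ^ 5 \<le> 3 * sqrt pi / 8 / sqrt m ^ 5"
      using m by (intro divide_right_mono truncated_gaussian_moment4_le) simp
    ultimately show ?thesis by (simp add: F_def)
  qed
  finally show ?thesis by (simp add: f_def)
qed

section \<open>The Riesz function and the Baez-Duarte sequence\<close>

text \<open>
  This explicit inequality carries the whole asymptotic statement. The Moebius signs are discarded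
  termwise, so it bounds every partial sum of the difference and hence its limit.
\<close>

lemma riesz_minus_baez_duarte_le:
  assumes k: "k \<ge> 2"
  shows "\<bar>riesz (real k) / real k - baez_duarte k\<bar>
    \<le> real k / 2 * (3 * sqrt pi / 8 / sqrt (real k - 1) ^ 5 + 27 / (real k - 1) ^ 3)"
proof -
  define t :: "nat \<Rightarrow> real" where "t n = 1 / real (Suc n) ^ 2" for n
  define w where "w n = moebius_mu (Suc n) * t n" for n
  define b where "b j = 1 / riemann_zeta (2 * real j + 2)" for j
  have t: "0 \<le> t n" "t n \<le> 1" for n
    unfolding t_def by (auto simp del: of_nat_Suc simp: divide_le_eq_1)
  have wt: "\<bar>w n\<bar> \<le> t n" for n
    using abs_moebius_mu_le_1[of "Suc n"] t(1)[of n] by (simp add: w_def abs_mult mult_left_le_one_le)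
  have st: "summable t"
    using inverse_power_summable[of 2, where 'a = real] unfolding t_def
    by (subst summable_Suc_iff[where f = "\<lambda>n. 1 / real n ^ 2"]) (simp add: inverse_eq_divide)
  have sw: "summable (\<lambda>n. \<bar>w n\<bar>)"
    by (rule summable_comparison_test'[OF st]) (use wt in simp)
  have b: "(\<lambda>n. w n * t n ^ j) sums b j" for j
    using moebius_mu_dirichlet_series[of "2 * j + 2"]
    by (simp add: w_def t_def b_def power_divide power_add add_ac power2_eq_square power_mult_distrib mult_ac power_mult)
  have R: "(\<lambda>n. w n * exp (- real k * t n)) sums (riesz (real k) / real k)"
  proof -
    have "riesz (real k) / real k = (\<Sum>j. (- real k) ^ j / fact j * b j)"
      using k by (simp add: riesz_def b_def power_minus[of "real k"])
    then show ?thesis using exponential_generating_function_of_moments[OF sw t b, of "- real k"] by simp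
  qed
  have c: "(\<lambda>n. w n * (1 - t n) ^ k) sums baez_duarte k"
  proof -
    have "(\<lambda>n. \<Sum>j=0..k. (-1) ^ j * real (k choose j) * (w n * t n ^ j)) sums baez_duarte k"
      unfolding baez_duarte_def by (intro sums_sum sums_mult b[unfolded b_def])
    moreover have "(\<Sum>j=0..k. (-1) ^ j * real (k choose j) * (w n * t n ^ j)) = w n * (1 - t n) ^ k" for n
      using binomial_ring[of "- t n" 1 k]
      by (simp add: sum_distrib_left atLeast0AtMost power_minus[of "t n"] mult_ac)
    ultimately show ?thesis by simp
  qed
  define d where "d n = w n * (exp (- real k * t n) - (1 - t n) ^ k)" for n
  have D: "d sums (riesz (real k) / real k - baez_duarte k)"
    unfolding d_def using sums_diff[OF R c] by (simp add: algebra_simps)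
  have dle: "\<bar>d n\<bar> \<le> real k / 2 * (exp (- (real k - 1) / real (Suc n) ^ 2) / real (Suc n) ^ 6)" for n
  proof -
    have "\<bar>d n\<bar> \<le> t n * (real k * (t n)\<^sup>2 / 2 * exp (- (real k - 1) * t n))"
      unfolding d_def abs_mult
      using k t wt by (intro mult_mono exp_minus_power_bounds) auto
    also have "\<dots> = real k / 2 * (exp (- (real k - 1) / real (Suc n) ^ 2) / real (Suc n) ^ 6)"
      by (simp del: of_nat_Suc add: t_def power_divide eval_nat_numeral mult_ac)
    finally show ?thesis .
  qed
  let ?B = "real k / 2 * (3 * sqrt pi / 8 / sqrt (real k - 1) ^ 5 + 27 / (real k - 1) ^ 3)"
  have partial: "\<bar>\<Sum>n<M. d n\<bar> \<le> ?B" for M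
  proof -
    have "\<bar>\<Sum>n<M. d n\<bar> \<le> (\<Sum>n<M. real k / 2 * (exp (- (real k - 1) / real (Suc n) ^ 2) / real (Suc n) ^ 6))"
      by (rule order_trans[OF sum_abs sum_mono[OF dle]])
    also have "\<dots> = real k / 2 * (\<Sum>n=1..M. exp (- (real k - 1) / real n ^ 2) / real n ^ 6)"
      by (simp only: sum_distrib_left[symmetric] One_nat_def sum.atLeast1_atMost_eq)
    also have "\<dots> \<le> ?B"
      using k by (intro mult_left_mono sum_inverse_power6_gaussian_le) auto
    finally show ?thesis .
  qed
  have "(\<lambda>M. \<bar>\<Sum>n<M. d n\<bar>) \<longlonglongrightarrow> \<bar>riesz (real k) / real k - baez_duarte k\<bar>"
    using D unfolding sums_def by (rule tendsto_rabs)
  then show ?thesis by (rule LIMSEQ_le_const2) (use partial in blast)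
qed

theorem lemma3:
  shows "\<exists>C::real. \<forall>\<^sub>F k::nat in sequentially.
    \<bar>riesz (real k) / real k - baez_duarte k\<bar>
      \<le> 3 * sqrt pi / 16 * real k powr (- (3 / 2)) + C * real k powr (- 2)"
proof -
  \<comment> \<open>Replacing \<open>k - 1\<close> by \<open>k\<close> in the first term costs \<open>O(k ^ (-5/2))\<close>, and the second term is
    asymptotic to \<open>27/2 * k ^ (-2)\<close>, so every \<open>C > 27/2\<close> works.\<close>
  have "\<forall>\<^sub>F k::nat in sequentially. real k / 2 * (3 * sqrt pi / 8 / sqrt (real k - 1) ^ 5 + 27 / (real k - 1) ^ 3)
      \<le> 3 * sqrt pi / 16 * real k powr (- (3 / 2)) + 14 * real k powr (- 2)"
    by real_asymp
  then have "\<forall>\<^sub>F k::nat in sequentially. \<bar>riesz (real k) / real k - baez_duarte k\<bar>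
      \<le> 3 * sqrt pi / 16 * real k powr (- (3 / 2)) + 14 * real k powr (- 2)"
    using eventually_ge_at_top[of 2]
    by eventually_elim (use riesz_minus_baez_duarte_le in fastforce)
  then show ?thesis by blast
qed

end
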